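(* Let $(X,T)$ be a dynamical system. For every $x\in X$, the set $\omega_{\mathcal{N}_T}(x)$ is a positively $T$-invariant closed subset of $X$.
   Context: A dynamical system $(X,T)$ consists of a nonempty compact metric space $X$ and a continuous surjective map $T:X\to X$; by standing assumption $X$ has no isolated points and is not a singleton. $\mathbb{Z}_+$ is the set of nonnegative integers. "Opene" means open and nonempty. For opene $U,V\subset X$ put $N_T(U,V)=\{n\in\mathbb{Z}_+: U\cap T^{-n}V\neq\varnothing\}$, and for $x\in X$, $G\subset X$ put $N_T(x,G)=\{n\in\mathbb{Z}_+: T^nx\in G\}$. $\mathcal{N}_T$ is the set of all subsets of $\mathbb{Z}_+$ containing some $N_T(U,V)$ with $U,V$ opene. For $x\in X$, $\omega_{\mathcal{N}_T}(x)=\bigcap_{F\in\mathcal{N}_T}\overline{\{T^ix:i\in F\}}$, i.e. the set (possibly empty) of $z\in X$ such that $N_T(x,G)\cap N_T(U,V)\neq\varnothing$ for every neighborhood $G$ of $z$ and all opene $U,V\subset X$. A set $A\subset X$ is positively $T$-invariant if $TA\subset A$. *)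

theory Defs
  imports "HOL-Analysis.Analysis"
begin

text \<open>
  The phase space is a subset \<open>X\<close> of a metric space, with the induced metric; open, closed
  and closure are always taken relative to \<open>X\<close>, i.e. in \<open>top_of_set X\<close>.
  The values of \<open>T\<close> outside \<open>X\<close> are irrelevant.
\<close>

locale dynamical_system =
  fixes X :: "'a::metric_space set" and T :: "'a \<Rightarrow> 'a"
  assumes nonempty: "X \<noteq> {}"
    and compact: "compact X"
    and continuous: "continuous_on X T"
    and surjective: "T ` X = X"
    and no_isolated_points: "\<And>x. \<not> x isolated_in X"
    and not_singleton: "\<not> is_singleton X"

definition opene :: "'a::metric_space set \<Rightarrow> 'a set \<Rightarrow> bool" where
  "opene X U \<longleftrightarrow> openin (top_of_set X) U \<and> U \<noteq> {}"

text \<open>The preimage under \<open>T ^^ n\<close> is intersected with \<open>X\<close>, as \<open>T\<close> is a map of \<open>X\<close>.\<close>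

definition hitting_times :: "'a set \<Rightarrow> ('a \<Rightarrow> 'a) \<Rightarrow> 'a set \<Rightarrow> 'a set \<Rightarrow> nat set" where
  "hitting_times X T U V = {n. U \<inter> ((T ^^ n) -` V \<inter> X) \<noteq> {}}"

definition hitting_family :: "'a::metric_space set \<Rightarrow> ('a \<Rightarrow> 'a) \<Rightarrow> nat set set" where
  "hitting_family X T = {F. \<exists>U V. opene X U \<and> opene X V \<and> hitting_times X T U V \<subseteq> F}"

definition omega_hitting :: "'a::metric_space set \<Rightarrow> ('a \<Rightarrow> 'a) \<Rightarrow> 'a \<Rightarrow> 'a set" where
  "omega_hitting X T x =
     (\<Inter>F\<in>hitting_family X T. top_of_set X closure_of {(T ^^ i) x |i. i \<in> F})"

definition positively_invariant :: "'a set \<Rightarrow> ('a \<Rightarrow> 'a) \<Rightarrow> 'a set \<Rightarrow> bool" where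
  "positively_invariant X T A \<longleftrightarrow> A \<subseteq> X \<and> T ` A \<subseteq> A"

end

theory Submission
  imports Defs
begin

text \<open>
  Closedness is immediate, since \<^term>\<open>omega_hitting X T x\<close> is the intersection of a nonempty
  family of closed subsets of \<open>X\<close>.

  Invariance holds because the hitting family is closed under the shift \<open>F \<mapsto> {i. Suc i \<in> F}\<close>
  (\<open>hitting_family_shift\<close>). If \<open>z\<close> is in the limit set and \<open>F\<close> is in the family, then \<open>z\<close> is in
  the closure of the points \<open>(T ^^ i) x\<close> with \<open>Suc i \<in> F\<close>; by continuity \<open>T z\<close> is in the closure
  of their images, and these are points \<open>(T ^^ j) x\<close> with \<open>j \<in> F\<close>.
\<close>

lemma (in dynamical_system) continuous_map_self:
  "continuous_map (top_of_set X) (top_of_set X) T"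
  using continuous surjective by (auto simp: continuous_map_in_subtopology)

lemma (in dynamical_system) opene_preimage:
  assumes "opene X V"
  shows "opene X (X \<inter> T -` V)"
proof -
  have V: "openin (top_of_set X) V" "V \<noteq> {}"
    using assms by (simp_all add: opene_def)
  have "openin (top_of_set X) {y \<in> topspace (top_of_set X). T y \<in> V}"
    using continuous_map_self V(1) by (rule openin_continuous_map_preimage)
  moreover have "{y \<in> topspace (top_of_set X). T y \<in> V} = X \<inter> T -` V"
    by auto
  moreover have "V \<subseteq> T ` X"
    using openin_imp_subset[OF V(1)] by (simp only: surjective)
  then have "X \<inter> T -` V \<noteq> {}"
    using V(2) by blast
  ultimately show ?thesis
    by (simp add: opene_def)
qed

text \<open>
  Reaching \<open>V\<close> at time \<open>i + 1\<close> means reaching the preimage of \<open>V\<close> at time \<open>i\<close>, so shifting the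
  hitting times of \<open>(U, V)\<close> down by one gives the hitting times of \<open>U\<close> and that preimage. The
  preimage is again a legitimate target: open by continuity, nonempty by surjectivity.
\<close>

lemma (in dynamical_system) hitting_family_shift:
  assumes "F \<in> hitting_family X T"
  shows "{i. Suc i \<in> F} \<in> hitting_family X T"
proof -
  obtain U V where UV: "opene X U" "opene X V" "hitting_times X T U V \<subseteq> F"
    using assms unfolding hitting_family_def by blast
  have "hitting_times X T U (X \<inter> T -` V) \<subseteq> {i. Suc i \<in> F}"
  proof
    fix i
    assume "i \<in> hitting_times X T U (X \<inter> T -` V)"
    then obtain u where u: "u \<in> U" "u \<in> X" "(T ^^ i) u \<in> T -` V"
      unfolding hitting_times_def by blast
    then have "(T ^^ Suc i) u \<in> V"
      by simp
    with u(1,2) have "Suc i \<in> hitting_times X T U V"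
      unfolding hitting_times_def by blast
    with UV(3) show "i \<in> {i. Suc i \<in> F}"
      by blast
  qed
  with UV(1) opene_preimage[OF UV(2)] show ?thesis
    unfolding hitting_family_def by (intro CollectI exI conjI)
qed

text \<open>
  An intersection over the empty family would be the whole type rather than a subset of \<open>X\<close>.
\<close>

lemma (in dynamical_system) hitting_family_nonempty: "hitting_family X T \<noteq> {}"
proof -
  have "opene X X"
    using nonempty by (simp add: opene_def)
  then have "UNIV \<in> hitting_family X T"
    unfolding hitting_family_def by blast
  then show ?thesis
    by blast
qed

lemma (in dynamical_system) closedin_omega_hitting:
  "closedin (top_of_set X) (omega_hitting X T x)"
  unfolding omega_hitting_def
  using hitting_family_nonempty by (intro closedin_Inter) auto

lemma (in dynamical_system) image_omega_hitting_subset: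
  "T ` omega_hitting X T x \<subseteq> omega_hitting X T x"
proof -
  have "T z \<in> top_of_set X closure_of {(T ^^ j) x |j. j \<in> F}"
    if z: "z \<in> omega_hitting X T x" and F: "F \<in> hitting_family X T" for z F
  proof -
    have "z \<in> top_of_set X closure_of {(T ^^ i) x |i. i \<in> {i. Suc i \<in> F}}"
      using z hitting_family_shift[OF F] unfolding omega_hitting_def by (rule INT_D)
    then have "T z \<in> top_of_set X closure_of (T ` {(T ^^ i) x |i. i \<in> {i. Suc i \<in> F}})"
      using continuous_map_image_closure_subset[OF continuous_map_self] by blast
    moreover have "T ` {(T ^^ i) x |i. i \<in> {i. Suc i \<in> F}} \<subseteq> {(T ^^ j) x |j. j \<in> F}"
    proof
      fix y
      assume "y \<in> T ` {(T ^^ i) x |i. i \<in> {i. Suc i \<in> F}}"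
      then obtain i where i: "Suc i \<in> F" "y = T ((T ^^ i) x)"
        by blast
      then have "y = (T ^^ Suc i) x"
        by simp
      with i(1) show "y \<in> {(T ^^ j) x |j. j \<in> F}"
        by blast
    qed
    ultimately show ?thesis
      by (rule subsetD[OF closure_of_mono, rotated])
  qed
  then have "T z \<in> omega_hitting X T x" if "z \<in> omega_hitting X T x" for z
    using that by (subst omega_hitting_def) (rule INT_I)
  then show ?thesis
    by blast
qed

theorem lemma3p3:
  fixes X :: "'a::metric_space set" and T :: "'a \<Rightarrow> 'a" and x :: 'a
  assumes "dynamical_system X T"
    and "x \<in> X"
  shows "positively_invariant X T (omega_hitting X T x)
    \<and> closedin (top_of_set X) (omega_hitting X T x)"
proof -
  interpret dynamical_system X T
    by (fact assms(1))
  show ?thesis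
    using closedin_omega_hitting[of x] image_omega_hitting_subset[of x]
      closedin_subset[OF closedin_omega_hitting[of x]]
    by (simp add: positively_invariant_def)
qed

end
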